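(* Let $\mathbb{A}$ be a PCA with elementary sub-PCA $\mathbb{A}'$. The strong Weihrauch lattice (the poset of strong Weihrauch degrees of partial multi-valued functions on $\mathbb{A}$, relative to $\mathbb{A}'$) is isomorphic to $\mathfrak{SW}(\overline 1)$, where $\mathfrak{SW}$ is the strong Weihrauch doctrine and $\overline 1=\{k\}$ is the terminal object of $\mathsf{Mod}_{\mathsf p}(\mathbb{A},\mathbb{A}')$.
   Context: A partial combinatory algebra (PCA) is a set $\mathbb{A}$ with a partial binary operation $\cdot$ (application, associating to the left; $ab\downarrow$ means that $ab$ is defined; $x\simeq y$ means that $x$ is defined whenever $y$ is, in which case they are equal) for which there exist $k,s\in\mathbb{A}$ such that for all $a,b,c\in\mathbb{A}$: $ka\downarrow$, $kab\simeq a$, $sa\downarrow$, $sab\downarrow$, $sabc\simeq ac(bc)$. An elementary sub-PCA is a subset $\mathbb{A}'\subseteq\mathbb{A}$ closed under (defined) application that contains elements $k,s$ such that $ka\downarrow$, $kab\simeq a$, $sa\downarrow$, $sab\downarrow$ and $sabc\simeq ac(bc)$ for all $a,b,c\in\mathbb{A}$; we fix such $k,s\in\mathbb{A}'$. Fix pairing and projection elements $\mathsf{pair},\mathsf{fst},\mathsf{snd}\in\mathbb{A}'$ with $\mathsf{fst}\cdot(\mathsf{pair}\,a\,b)=a$, $\mathsf{snd}\cdot(\mathsf{pair}\,a\,b)=b$, and write $\langle a,b\rangle:=\mathsf{pair}\,a\,b$. $\wp^*(\mathbb{A})$ is the set of nonempty subsets of $\mathbb{A}$. Assertions such as $a\cdot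 b\in S$ include that $a\cdot b$ is defined. $\mathsf{Mod}_{\mathsf p}(\mathbb{A},\mathbb{A}')$ is the category with objects the subsets $X\subseteq\mathbb{A}$ and morphisms $X\to Y$ the computable functions, i.e. the functions $f\colon X\to Y$ for which there is $a\in\mathbb{A}'$ with $a\cdot x\downarrow$ and $f(x)=a\cdot x$ for all $x\in X$. Its products are $X\times Y=\{\langle x,y\rangle:x\in X,y\in Y\}$. With abuse of notation, $\overline k\cdot p$ denotes the value at $p$ of a computable function $\overline k$. Strong Weihrauch reducibility: a partial multi-valued function on $\mathbb{A}$ with domain $X\subseteq\mathbb{A}$ is a function $f\colon X\to\wp^*(\mathbb{A})$. For $f\colon X\to\wp^*(\mathbb{A})$ and $g\colon Z\to\wp^*(\mathbb{A})$, $f\le_{\mathrm{sW}}g$ iff there are a computable function $\overline k\colon X\to Z$ and $\overline h\in\mathbb{A}'$ such that $(\forall p\in X)(\forall q\in g(\overline k\cdot p))(\overline h\cdot q\in f(p))$. The strong Weihrauch degrees are the poset reflection of this preorder. Strong Weihrauch doctrine $\mathfrak{SW}\colon\mathsf{Mod}_{\mathsf p}(\mathbb{A},\mathbb{A}')^{\mathrm{op}}\to\mathsf{Pos}$: $\mathfrak{SW}(X)$ is the poset reflection of the preorder whose objects are generalized Weihrauch predicates on $X$, i.e. functions $F\colon X\to\wp^*(\mathbb{A})^Y$ for some $Y\subseteq\mathbb{A}$ (write $F(x,y)=F(x)(y)$), with $F\le_{\mathsf{sW}}G$, for $F\colon X\to\wp^*(\mathbb{A})^Y$ and $G\colon X\to\wp^*(\mathbb{A})^Z$,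 iff there are a computable function $\overline k\colon X\times Y\to Z$ and $\overline h\in\mathbb{A}'$ such that $(\forall\langle x,y\rangle\in X\times Y)(\forall q\in G(x,\overline k\cdot\langle x,y\rangle))(\overline h\cdot q\in F(x,y))$. It acts by precomposition. *)

theory Defs
  imports "HOL-Library.FuncSet"
begin

text \<open>
  The underlying set of a PCA is the type \<open>'a\<close>; its partial application is a function
  \<open>app :: 'a \<Rightarrow> 'a \<Rightarrow> 'a option\<close>, with \<open>None\<close> for ``undefined''.
\<close>

type_synonym 'a papp = "'a \<Rightarrow> 'a \<Rightarrow> 'a option"

text \<open>Strict extension of application to possibly undefined terms.\<close>

definition oapp :: "'a papp \<Rightarrow> 'a option \<Rightarrow> 'a option \<Rightarrow> 'a option" where
  "oapp app u v = Option.bind u (\<lambda>a. Option.bind v (app a))"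

text \<open>The directed relation \<open>u \<simeq> v\<close>: if \<open>v\<close> is defined then so is \<open>u\<close>, and they are equal.\<close>

definition refines :: "'a option \<Rightarrow> 'a option \<Rightarrow> bool" where
  "refines u v \<longleftrightarrow> (v \<noteq> None \<longrightarrow> u = v)"

definition ks_combinators :: "'a papp \<Rightarrow> 'a \<Rightarrow> 'a \<Rightarrow> bool" where
  "ks_combinators app k s \<longleftrightarrow>
     (\<forall>a b c.
        app k a \<noteq> None \<and>
        refines (oapp app (app k a) (Some b)) (Some a) \<and>
        app s a \<noteq> None \<and>
        oapp app (app s a) (Some b) \<noteq> None \<and>
        refines (oapp app (oapp app (app s a) (Some b)) (Some c))
                (oapp app (app a c) (app b c)))"

definition pca :: "'a papp \<Rightarrow> bool" where
  "pca app \<longleftrightarrow> (\<exists>k s. ks_combinators app k s)"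

definition elementary_sub_pca :: "'a papp \<Rightarrow> 'a set \<Rightarrow> bool" where
  "elementary_sub_pca app A' \<longleftrightarrow>
     (\<forall>a\<in>A'. \<forall>b\<in>A'. \<forall>c. app a b = Some c \<longrightarrow> c \<in> A') \<and>
     (\<exists>k\<in>A'. \<exists>s\<in>A'. ks_combinators app k s)"

definition pairing_combinators :: "'a papp \<Rightarrow> 'a \<Rightarrow> 'a \<Rightarrow> 'a \<Rightarrow> bool" where
  "pairing_combinators app pair fst' snd' \<longleftrightarrow>
     (\<forall>a b. oapp app (Some fst') (oapp app (app pair a) (Some b)) = Some a \<and>
            oapp app (Some snd') (oapp app (app pair a) (Some b)) = Some b)"

text \<open>
  The code of a pair, \<open>\<langle>a, b\<rangle>\<close>. It is always defined when \<open>pair\<close> comes from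
  \<^const>\<open>pairing_combinators\<close>.
\<close>

definition tup :: "'a papp \<Rightarrow> 'a \<Rightarrow> 'a \<Rightarrow> 'a \<Rightarrow> 'a" where
  "tup app pair a b = the (oapp app (app pair a) (Some b))"

text \<open>
  The category \<open>Mod\<^sub>p(A, A')\<close>: objects are all subsets of the PCA. Morphisms are represented as
  extensional functions, so that a morphism is determined by its values on its domain.
\<close>

definition modp_hom :: "'a papp \<Rightarrow> 'a set \<Rightarrow> 'a set \<Rightarrow> 'a set \<Rightarrow> ('a \<Rightarrow> 'a) set" where
  "modp_hom app A' X Y = {f \<in> X \<rightarrow>\<^sub>E Y. \<exists>a\<in>A'. \<forall>x\<in>X. app a x = Some (f x)}"

definition modp_prod :: "'a papp \<Rightarrow> 'a \<Rightarrow> 'a set \<Rightarrow> 'a set \<Rightarrow> 'a set" where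
  "modp_prod app pair X Y = {tup app pair x y | x y. x \<in> X \<and> y \<in> Y}"

definition nonempty_subsets :: "'a set set" where
  "nonempty_subsets = {S. S \<noteq> {}}"


text \<open>
  A poset is given by its carrier and its order relation. The order on the poset reflection is the
  one induced on equivalence classes, and does not depend on representatives when \<open>r\<close> is a
  preorder on \<open>P\<close>.
\<close>

type_synonym 'x ordered_set = "'x set \<times> 'x rel"

definition is_poset :: "'x ordered_set \<Rightarrow> bool" where
  "is_poset P \<longleftrightarrow> partial_order_on (fst P) (snd P)"

definition poset_reflection :: "'x set \<Rightarrow> 'x rel \<Rightarrow> 'x set ordered_set" where
  "poset_reflection P r =
     (P // (r \<inter> r\<inverse>),
      {(C, D). C \<in> P // (r \<inter> r\<inverse>) \<and> D \<in> P // (r \<inter> r\<inverse>) \<and> (\<exists>x\<in>C. \<exists>y\<in>D. (x, y) \<in> r)})"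

definition poset_isomorphic :: "'x ordered_set \<Rightarrow> 'y ordered_set \<Rightarrow> bool" where
  "poset_isomorphic P Q \<longleftrightarrow>
     (\<exists>\<phi>. bij_betw \<phi> (fst P) (fst Q) \<and>
          (\<forall>x\<in>fst P. \<forall>y\<in>fst P. (x, y) \<in> snd P \<longleftrightarrow> (\<phi> x, \<phi> y) \<in> snd Q))"


text \<open>A partial multi-valued function is a pair of its domain and an extensional function on it.\<close>

type_synonym 'a pmv = "'a set \<times> ('a \<Rightarrow> 'a set)"

definition pmv_functions :: "'a pmv set" where
  "pmv_functions = {(X, f). f \<in> X \<rightarrow>\<^sub>E nonempty_subsets}"

definition sW_le :: "'a papp \<Rightarrow> 'a set \<Rightarrow> 'a pmv \<Rightarrow> 'a pmv \<Rightarrow> bool" where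
  "sW_le app A' = (\<lambda>(X, f) (Z, g).
     \<exists>\<kappa> \<in> modp_hom app A' X Z. \<exists>h\<in>A'.
       \<forall>p\<in>X. \<forall>q\<in>g (\<kappa> p). \<exists>r\<in>f p. app h q = Some r)"

definition sW_rel :: "'a papp \<Rightarrow> 'a set \<Rightarrow> 'a pmv rel" where
  "sW_rel app A' = {(F, G). F \<in> pmv_functions \<and> G \<in> pmv_functions \<and> sW_le app A' F G}"

definition sW_lattice :: "'a papp \<Rightarrow> 'a set \<Rightarrow> 'a pmv set ordered_set" where
  "sW_lattice app A' = poset_reflection pmv_functions (sW_rel app A')"


text \<open>
  A generalized Weihrauch predicate \<open>F : X \<rightarrow> \<wp>\<^sup>*(A)\<^bsup>Y\<^esup>\<close> is represented as the pair \<open>(Y, F)\<close>.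
  The set \<open>Y\<close> is kept as part of the data because it cannot be recovered from \<open>F\<close> if \<open>X\<close> is empty.
\<close>

type_synonym 'a gwp = "'a set \<times> ('a \<Rightarrow> 'a \<Rightarrow> 'a set)"

definition gw_predicates :: "'a set \<Rightarrow> 'a gwp set" where
  "gw_predicates X = {(Y, F). F \<in> X \<rightarrow>\<^sub>E (Y \<rightarrow>\<^sub>E nonempty_subsets)}"

definition SW_le :: "'a papp \<Rightarrow> 'a set \<Rightarrow> 'a \<Rightarrow> 'a set \<Rightarrow> 'a gwp \<Rightarrow> 'a gwp \<Rightarrow> bool" where
  "SW_le app A' pair X = (\<lambda>(Y, F) (Z, G).
     \<exists>\<kappa> \<in> modp_hom app A' (modp_prod app pair X Y) Z. \<exists>h\<in>A'.
       \<forall>x\<in>X. \<forall>y\<in>Y. \<forall>q\<in>G x (\<kappa> (tup app pair x y)). \<exists>r\<in>F x y. app h q = Some r)"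

definition SW_rel :: "'a papp \<Rightarrow> 'a set \<Rightarrow> 'a \<Rightarrow> 'a set \<Rightarrow> 'a gwp rel" where
  "SW_rel app A' pair X =
     {(F, G). F \<in> gw_predicates X \<and> G \<in> gw_predicates X \<and> SW_le app A' pair X F G}"

text \<open>The fibre over \<open>X\<close> of the strong Weihrauch doctrine.\<close>

definition SW :: "'a papp \<Rightarrow> 'a set \<Rightarrow> 'a \<Rightarrow> 'a set \<Rightarrow> 'a gwp set ordered_set" where
  "SW app A' pair X = poset_reflection (gw_predicates X) (SW_rel app A' pair X)"




lemma poset_reflection_is_poset:
  assumes "preorder_on P r"
  shows "is_poset (poset_reflection P r)"
proof -
  let ?e = "r \<inter> r\<inverse>"
  have sub: "r \<subseteq> P \<times> P" and re: "\<And>x. x \<in> P \<Longrightarrow> (x, x) \<in> r" and tr: "trans r"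
    using assms by (auto simp: preorder_on_def refl_on_def)
  have e: "equiv P ?e"
  proof (rule equivI)
    show "?e \<subseteq> P \<times> P" using sub by auto
    show "refl_on P ?e" using re by (auto simp: refl_on_def)
    show "sym ?e" by (auto simp: sym_def)
    show "trans ?e" using tr unfolding trans_def by blast
  qed
  have cls: "(x, y) \<in> r" if "C \<in> P // ?e" "x \<in> C" "y \<in> C" for C x y
    using quotient_eq_iff[OF e that(1) that(1) that(2,3)] by auto
  have nonempty: "\<exists>x. x \<in> C" if "C \<in> P // ?e" for C
    using in_quotient_imp_non_empty[OF e that] by blast
  have eq: "C = D" if "C \<in> P // ?e" "D \<in> P // ?e" "x \<in> C" "y \<in> D" "(x, y) \<in> r" "(y, x) \<in> r" for C D x y
    using quotient_eq_iff[OF e that(1-4)] that(5,6) by auto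
  show ?thesis
    unfolding is_poset_def poset_reflection_def partial_order_on_def preorder_on_def fst_conv snd_conv
  proof (intro conjI)
    show "refl_on (P // ?e) {(C, D). C \<in> P // ?e \<and> D \<in> P // ?e \<and> (\<exists>x\<in>C. \<exists>y\<in>D. (x, y) \<in> r)}"
      using nonempty cls by (fastforce simp: refl_on_def)
    show "trans {(C, D). C \<in> P // ?e \<and> D \<in> P // ?e \<and> (\<exists>x\<in>C. \<exists>y\<in>D. (x, y) \<in> r)}"
    proof (rule transI)
      fix C D E
      assume "(C, D) \<in> {(C, D). C \<in> P // ?e \<and> D \<in> P // ?e \<and> (\<exists>x\<in>C. \<exists>y\<in>D. (x, y) \<in> r)}"
        and "(D, E) \<in> {(C, D). C \<in> P // ?e \<and> D \<in> P // ?e \<and> (\<exists>x\<in>C. \<exists>y\<in>D. (x, y) \<in> r)}"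
      then obtain x y y' z where *: "C \<in> P // ?e" "D \<in> P // ?e" "E \<in> P // ?e"
        "x \<in> C" "y \<in> D" "y' \<in> D" "z \<in> E" "(x, y) \<in> r" "(y', z) \<in> r"
        by auto
      have "(x, z) \<in> r"
        using transD[OF tr transD[OF tr *(8) cls[OF *(2,5,6)]] *(9)] .
      with * show "(C, E) \<in> {(C, D). C \<in> P // ?e \<and> D \<in> P // ?e \<and> (\<exists>x\<in>C. \<exists>y\<in>D. (x, y) \<in> r)}"
        by auto
    qed
    show "antisym {(C, D). C \<in> P // ?e \<and> D \<in> P // ?e \<and> (\<exists>x\<in>C. \<exists>y\<in>D. (x, y) \<in> r)}"
    proof (rule antisymI)
      fix C D
      assume "(C, D) \<in> {(C, D). C \<in> P // ?e \<and> D \<in> P // ?e \<and> (\<exists>x\<in>C. \<exists>y\<in>D. (x, y) \<in> r)}"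
        and "(D, C) \<in> {(C, D). C \<in> P // ?e \<and> D \<in> P // ?e \<and> (\<exists>x\<in>C. \<exists>y\<in>D. (x, y) \<in> r)}"
      then obtain x y y' x' where *: "C \<in> P // ?e" "D \<in> P // ?e"
        "x \<in> C" "y \<in> D" "y' \<in> D" "x' \<in> C" "(x, y) \<in> r" "(y', x') \<in> r"
        by auto
      have "(y, x) \<in> r"
        using transD[OF tr transD[OF tr cls[OF *(2,4,5)] *(8)] cls[OF *(1,6,3)]] .
      then show "C = D" using eq[OF *(1-4,7)] by blast
    qed
  qed auto
qed

context
  fixes app :: "'a papp" and A' :: "'a set" and k s pair fst' snd' :: 'a
  assumes sub: "elementary_sub_pca app A'"
    and kA: "k \<in> A'" and sA: "s \<in> A'" and ks: "ks_combinators app k s"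
begin

lemma sub_closed: "app a b = Some c \<Longrightarrow> a \<in> A' \<Longrightarrow> b \<in> A' \<Longrightarrow> c \<in> A'"
  using sub[unfolded elementary_sub_pca_def, THEN conjunct1, rule_format] .

lemma k_app: "\<exists>u. app k a = Some u \<and> (\<forall>b. app u b = Some a)"
proof -
  have *: "app k a \<noteq> None" "refines (oapp app (app k a) (Some b)) (Some a)" for b
    using ks unfolding ks_combinators_def by simp_all
  obtain u where u: "app k a = Some u" using *(1) by (cases "app k a") simp_all
  have "app u b = Some a" for b using *(2)[of b] by (simp add: refines_def oapp_def u)
  with u show ?thesis by simp
qed

lemma s_app:
  "\<exists>v w. app s a = Some v \<and> app v b = Some w \<and>
     (\<forall>c x y z. app a c = Some x \<longrightarrow> app b c = Some y \<longrightarrow> app x y = Some z \<longrightarrow> app w c = Some z)"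
proof -
  have *: "app s a \<noteq> None" "oapp app (app s a) (Some b) \<noteq> None"
    "refines (oapp app (oapp app (app s a) (Some b)) (Some c)) (oapp app (app a c) (app b c))" for c
    using ks unfolding ks_combinators_def by simp_all
  obtain v where v: "app s a = Some v" using *(1) by (cases "app s a") simp_all
  obtain w where w: "app v b = Some w" using *(2) by (cases "app v b") (simp_all add: oapp_def v)
  have "app w c = Some z" if "app a c = Some x" "app b c = Some y" "app x y = Some z" for c x y z
    using *(3)[of c] by (simp add: refines_def oapp_def v w that)
  with v w show ?thesis by simp
qed

lemma const_ex:
  assumes "a \<in> A'" shows "\<exists>d\<in>A'. \<forall>x. app d x = Some a"
proof -
  obtain u where u: "app k a = Some u" "\<forall>b. app u b = Some a"
    using k_app[of a] by (elim exE conjE)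
  show ?thesis using u(2) sub_closed[OF u(1) kA assms] by (rule bexI)
qed

lemma s_ex:
  assumes "a \<in> A'" "b \<in> A'"
  shows "\<exists>d\<in>A'. \<forall>x u v w. app a x = Some u \<longrightarrow> app b x = Some v \<longrightarrow> app u v = Some w \<longrightarrow> app d x = Some w"
proof -
  obtain v w where vw: "app s a = Some v" "app v b = Some w"
    "\<forall>c x y z. app a c = Some x \<longrightarrow> app b c = Some y \<longrightarrow> app x y = Some z \<longrightarrow> app w c = Some z"
    using s_app[of a b] by (elim exE conjE)
  show ?thesis
    using vw(3) sub_closed[OF vw(2) sub_closed[OF vw(1) sA assms(1)] assms(2)] by (rule bexI)
qed

lemma id_ex: "\<exists>d\<in>A'. \<forall>x. app d x = Some x"
proof -
  obtain d where d: "d \<in> A'"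
    "\<forall>x u v w. app k x = Some u \<longrightarrow> app k x = Some v \<longrightarrow> app u v = Some w \<longrightarrow> app d x = Some w"
    using s_ex[OF kA kA] by (elim bexE)
  have "app d x = Some x" for x
  proof -
    obtain u where u: "app k x = Some u" "\<forall>b. app u b = Some x"
      using k_app[of x] by (elim exE conjE)
    show ?thesis using d(2)[rule_format, OF u(1) u(1) u(2)[rule_format]] .
  qed
  then show ?thesis using d(1) by (intro bexI[of _ d]) simp_all
qed

lemma comp_ex:
  assumes "a \<in> A'" "b \<in> A'"
  shows "\<exists>d\<in>A'. \<forall>x v w. app b x = Some v \<longrightarrow> app a v = Some w \<longrightarrow> app d x = Some w"
proof -
  obtain c where c: "c \<in> A'" "\<forall>x. app c x = Some a"
    using const_ex[OF assms(1)] by (elim bexE)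
  obtain d where d: "d \<in> A'"
    "\<forall>x u v w. app c x = Some u \<longrightarrow> app b x = Some v \<longrightarrow> app u v = Some w \<longrightarrow> app d x = Some w"
    using s_ex[OF c(1) assms(2)] by (elim bexE)
  have "app d x = Some w" if "app b x = Some v" "app a v = Some w" for x v w
    using d(2)[rule_format, OF c(2)[rule_format] that] .
  then show ?thesis using d(1) by (intro bexI[of _ d]) simp_all
qed

lemma singleton_k_terminal: "\<exists>!f. f \<in> modp_hom app A' X {k}"
proof (rule ex1I)
  show "(\<lambda>x\<in>X. k) \<in> modp_hom app A' X {k}"
    using const_ex[OF kA] by (auto simp: modp_hom_def)
  show "f = (\<lambda>x\<in>X. k)" if "f \<in> modp_hom app A' X {k}" for f
    using that by (intro ext) (auto simp: modp_hom_def PiE_iff extensional_def)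
qed

lemma sW_preorder: "preorder_on pmv_functions (sW_rel app A')"
  unfolding preorder_on_def
proof (intro conjI)
  obtain i where i: "i \<in> A'" "\<forall>x. app i x = Some x" using id_ex by (elim bexE)
  have "sW_le app A' (X, f) (X, f)" for X f
  proof -
    have "(\<lambda>x\<in>X. x) \<in> modp_hom app A' X X"
      using i by (auto simp: modp_hom_def)
    moreover have "\<forall>p\<in>X. \<forall>q\<in>f ((\<lambda>x\<in>X. x) p). \<exists>r\<in>f p. app i q = Some r"
      using i by auto
    ultimately show ?thesis unfolding sW_le_def using i(1) by blast
  qed
  then show "refl_on pmv_functions (sW_rel app A')"
    by (auto simp: refl_on_def sW_rel_def)
  show "trans (sW_rel app A')"
  proof (rule transI)
    fix P Q R assume PQ: "(P, Q) \<in> sW_rel app A'" and QR: "(Q, R) \<in> sW_rel app A'"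
    obtain X f Y g Z h where eqs: "P = (X, f)" "Q = (Y, g)" "R = (Z, h)" by (metis surj_pair)
    obtain m1 h1 a1 where 1: "m1 \<in> X \<rightarrow>\<^sub>E Y" "a1 \<in> A'" "\<forall>x\<in>X. app a1 x = Some (m1 x)" "h1 \<in> A'"
      "\<forall>p\<in>X. \<forall>q\<in>g (m1 p). \<exists>r\<in>f p. app h1 q = Some r"
      using PQ unfolding sW_rel_def eqs sW_le_def modp_hom_def by auto
    obtain m2 h2 a2 where 2: "m2 \<in> Y \<rightarrow>\<^sub>E Z" "a2 \<in> A'" "\<forall>x\<in>Y. app a2 x = Some (m2 x)" "h2 \<in> A'"
      "\<forall>p\<in>Y. \<forall>q\<in>h (m2 p). \<exists>r\<in>g p. app h2 q = Some r"
      using QR unfolding sW_rel_def eqs sW_le_def modp_hom_def by auto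
    obtain a where a: "a \<in> A'" "\<And>x v w. app a1 x = Some v \<Longrightarrow> app a2 v = Some w \<Longrightarrow> app a x = Some w"
      using comp_ex[OF 2(2) 1(2)] by blast
    obtain b where b: "b \<in> A'" "\<And>x v w. app h2 x = Some v \<Longrightarrow> app h1 v = Some w \<Longrightarrow> app b x = Some w"
      using comp_ex[OF 1(4) 2(4)] by (elim bexE) simp
    have m1Y: "m1 x \<in> Y" if "x \<in> X" for x using 1(1) that by auto
    have "(\<lambda>x\<in>X. m2 (m1 x)) \<in> modp_hom app A' X Z"
      unfolding modp_hom_def using 2(1) m1Y a 1(3) 2(3) by (auto intro!: bexI[of _ a])
    moreover have "\<forall>p\<in>X. \<forall>q\<in>h ((\<lambda>x\<in>X. m2 (m1 x)) p). \<exists>r\<in>f p. app b q = Some r"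
      using m1Y b(2) 1(5) 2(5) by simp metis
    ultimately have "sW_le app A' P R"
      unfolding sW_le_def eqs using b(1) by blast
    then show "(P, R) \<in> sW_rel app A'" using PQ QR by (auto simp: sW_rel_def)
  qed
qed (auto simp: sW_rel_def)

lemma sW_lattice_is_poset: "is_poset (sW_lattice app A')"
  unfolding sW_lattice_def by (intro poset_reflection_is_poset sW_preorder)

context
  assumes pA: "pair \<in> A'" and fA: "fst' \<in> A'" and nA: "snd' \<in> A'"
    and pairing: "pairing_combinators app pair fst' snd'"
begin

lemma tup_eq: "\<exists>u. app pair x = Some u \<and> app u y = Some (tup app pair x y)"
  and fst_tup: "app fst' (tup app pair x y) = Some x"
  and snd_tup: "app snd' (tup app pair x y) = Some y"
proof -
  note ab = pairing[unfolded pairing_combinators_def, THEN spec, of x, THEN spec, of y]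
  have a: "oapp app (Some fst') (oapp app (app pair x) (Some y)) = Some x"
    and b: "oapp app (Some snd') (oapp app (app pair x) (Some y)) = Some y"
    by (rule conjunct1[OF ab], rule conjunct2[OF ab])
  obtain u where u: "app pair x = Some u"
    using a by (cases "app pair x") (simp_all add: oapp_def)
  obtain v where v: "app u y = Some v"
    using a by (cases "app u y") (simp_all add: oapp_def u)
  have t: "tup app pair x y = v" by (simp add: tup_def oapp_def u v)
  show "\<exists>u. app pair x = Some u \<and> app u y = Some (tup app pair x y)" using u v t by simp
  show "app fst' (tup app pair x y) = Some x" using a by (simp add: oapp_def u v t)
  show "app snd' (tup app pair x y) = Some y" using b by (simp add: oapp_def u v t)
qed

lemma tup_inj: "tup app pair x y = tup app pair x' y' \<longleftrightarrow> x = x' \<and> y = y'"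
proof
  assume eq: "tup app pair x y = tup app pair x' y'"
  show "x = x' \<and> y = y'"
    using fst_tup[of x y] snd_tup[of x y] unfolding eq fst_tup snd_tup by simp
qed simp

lemma SW_preorder: "preorder_on (gw_predicates X) (SW_rel app A' pair X)"
  unfolding preorder_on_def
proof (intro conjI)
  let ?t = "tup app pair"
  let ?M = "modp_prod app pair X"
  obtain i where i: "i \<in> A'" "\<forall>x. app i x = Some x" using id_ex by (elim bexE)
  have "SW_le app A' pair X (Y, F) (Y, F)" for Y F
  proof -
    have "(\<lambda>p\<in>?M Y. the (app snd' p)) \<in> modp_hom app A' (?M Y) Y"
      unfolding modp_hom_def using snd_tup
      by (intro CollectI conjI bexI[OF _ nA]) (auto simp: modp_prod_def)
    moreover have mem: "?t x y \<in> ?M Y" if "x \<in> X" "y \<in> Y" for x y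
      using that by (auto simp: modp_prod_def)
    moreover have "\<forall>x\<in>X. \<forall>y\<in>Y. \<forall>q\<in>F x ((\<lambda>p\<in>?M Y. the (app snd' p)) (?t x y)). \<exists>r\<in>F x y. app i q = Some r"
      using i(2) snd_tup mem by simp
    ultimately show ?thesis unfolding SW_le_def using i(1) by blast
  qed
  then show "refl_on (gw_predicates X) (SW_rel app A' pair X)"
    by (auto simp: refl_on_def SW_rel_def)
  show "trans (SW_rel app A' pair X)"
  proof (rule transI)
    fix P Q R assume PQ: "(P, Q) \<in> SW_rel app A' pair X" and QR: "(Q, R) \<in> SW_rel app A' pair X"
    obtain Y F Z G W H where eqs: "P = (Y, F)" "Q = (Z, G)" "R = (W, H)" by (metis surj_pair)
    obtain m1 h1 a1 where 1: "m1 \<in> ?M Y \<rightarrow>\<^sub>E Z" "a1 \<in> A'" "\<forall>x\<in>?M Y. app a1 x = Some (m1 x)" "h1 \<in> A'"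
      "\<forall>x\<in>X. \<forall>y\<in>Y. \<forall>q\<in>G x (m1 (?t x y)). \<exists>r\<in>F x y. app h1 q = Some r"
      using PQ unfolding SW_rel_def eqs SW_le_def modp_hom_def by auto
    obtain m2 h2 a2 where 2: "m2 \<in> ?M Z \<rightarrow>\<^sub>E W" "a2 \<in> A'" "\<forall>x\<in>?M Z. app a2 x = Some (m2 x)" "h2 \<in> A'"
      "\<forall>x\<in>X. \<forall>y\<in>Z. \<forall>q\<in>H x (m2 (?t x y)). \<exists>r\<in>G x y. app h2 q = Some r"
      using QR unfolding SW_rel_def eqs SW_le_def modp_hom_def by auto
    obtain b where b: "b \<in> A'" "\<And>x v w. app h2 x = Some v \<Longrightarrow> app h1 v = Some w \<Longrightarrow> app b x = Some w"
      using comp_ex[OF 1(4) 2(4)] by (elim bexE) simp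
    obtain c where c: "c \<in> A'" "\<And>x v w. app fst' x = Some v \<Longrightarrow> app pair v = Some w \<Longrightarrow> app c x = Some w"
      using comp_ex[OF pA fA] by blast
    obtain d where d: "d \<in> A'"
      "\<And>x u v w. app c x = Some u \<Longrightarrow> app a1 x = Some v \<Longrightarrow> app u v = Some w \<Longrightarrow> app d x = Some w"
      using s_ex[OF c(1) 1(2)] by blast
    obtain a where a: "a \<in> A'" "\<And>x v w. app d x = Some v \<Longrightarrow> app a2 v = Some w \<Longrightarrow> app a x = Some w"
      using comp_ex[OF 2(2) d(1)] by blast
    have tP: "?t x y \<in> ?M V" if "x \<in> X" "y \<in> V" for x y V
      using that by (auto simp: modp_prod_def)
    have m1Z: "m1 (?t x y) \<in> Z" if "x \<in> X" "y \<in> Y" for x y using 1(1) tP[OF that] by auto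
    have dt: "app d (?t x y) = Some (?t x (m1 (?t x y)))" if "x \<in> X" "y \<in> Y" for x y
    proof -
      obtain u where "app pair x = Some u" "app u (m1 (?t x y)) = Some (?t x (m1 (?t x y)))"
        using tup_eq[of x "m1 (?t x y)"] by (elim exE conjE)
      then show ?thesis using d(2)[OF c(2)[OF fst_tup]] 1(3)[rule_format, OF tP[OF that]] by simp
    qed
    define m where "m = (\<lambda>p\<in>?M Y. the (app a p))"
    have at: "app a (?t x y) = Some (m2 (?t x (m1 (?t x y))))" if "x \<in> X" "y \<in> Y" for x y
      using a(2)[OF dt[OF that] 2(3)[rule_format, OF tP[OF that(1) m1Z[OF that]]]] .
    have mt: "m (?t x y) = m2 (?t x (m1 (?t x y)))" if "x \<in> X" "y \<in> Y" for x y
      using at[OF that] tP[OF that] by (simp add: m_def)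
    have m2W: "m2 (?t x (m1 (?t x y))) \<in> W" if "x \<in> X" "y \<in> Y" for x y
      using 2(1) tP[OF that(1) m1Z[OF that]] by auto
    have "m \<in> ?M Y \<rightarrow>\<^sub>E W"
    proof (rule PiE_I)
      fix p assume "p \<in> ?M Y"
      then obtain x y where "p = ?t x y" "x \<in> X" "y \<in> Y" by (auto simp: modp_prod_def)
      then show "m p \<in> W" using mt m2W by simp
    qed (simp add: m_def)
    moreover have "\<forall>p\<in>?M Y. app a p = Some (m p)"
    proof
      fix p assume "p \<in> ?M Y"
      then obtain x y where "p = ?t x y" "x \<in> X" "y \<in> Y" by (auto simp: modp_prod_def)
      then show "app a p = Some (m p)" using mt at by simp
    qed
    ultimately have "m \<in> modp_hom app A' (?M Y) W"
      unfolding modp_hom_def using a(1) by blast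
    moreover have "\<forall>x\<in>X. \<forall>y\<in>Y. \<forall>q\<in>H x (m (?t x y)). \<exists>r\<in>F x y. app b q = Some r"
    proof (intro ballI)
      fix x y q assume xy: "x \<in> X" "y \<in> Y" and q: "q \<in> H x (m (?t x y))"
      obtain r where r: "r \<in> G x (m1 (?t x y))" "app h2 q = Some r"
        using 2(5)[rule_format, OF xy(1) m1Z[OF xy], of q] q mt[OF xy] by auto
      obtain r' where "r' \<in> F x y" "app h1 r = Some r'"
        using 1(5)[rule_format, OF xy r(1)] by (elim bexE)
      then show "\<exists>r\<in>F x y. app b q = Some r"
        using b(2)[OF r(2)] by (intro bexI)
    qed
    ultimately have "SW_le app A' pair X P R"
      unfolding SW_le_def eqs using b(1) by blast
    then show "(P, R) \<in> SW_rel app A' pair X" using PQ QR by (auto simp: SW_rel_def)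
  qed
qed (auto simp: SW_rel_def)

lemma SW_is_poset: "is_poset (SW app A' pair X)"
  unfolding SW_def by (intro poset_reflection_is_poset SW_preorder)

end

end

end

theory Submission
  imports Defs
begin

text \<open>
  Evaluation at \<open>k\<close> identifies generalized predicates on \<open>{k}\<close> with partial multi-valued functions.
  The forward reduction functions correspond along the computable bijection between \<open>{k} \<times> X\<close> and
  \<open>X\<close> given by \<open>snd\<close> and \<open>pair k\<close>, and the backward ones are literally the same.
\<close>

lemma poset_reflection_isomorphic:
  assumes T: "bij_betw T P Q"
    and r: "r \<subseteq> P \<times> P" and r': "r' \<subseteq> Q \<times> Q"
    and iff: "\<And>x y. x \<in> P \<Longrightarrow> y \<in> P \<Longrightarrow> (x, y) \<in> r \<longleftrightarrow> (T x, T y) \<in> r'"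
  shows "poset_isomorphic (poset_reflection P r) (poset_reflection Q r')"
proof -
  let ?e = "r \<inter> r\<inverse>" and ?e' = "r' \<inter> r'\<inverse>"
  have inj: "inj_on T P" and img: "T ` P = Q"
    using T by (simp_all add: bij_betw_def)
  have cls: "T ` (?e `` {x}) = ?e' `` {T x}" if "x \<in> P" for x
  proof
    show "T ` (?e `` {x}) \<subseteq> ?e' `` {T x}"
      using iff r that by blast
    show "?e' `` {T x} \<subseteq> T ` (?e `` {x})"
    proof
      fix z assume z: "z \<in> ?e' `` {T x}"
      \<comment> \<open>Anything equivalent to \<open>T x\<close> lies in \<open>Q\<close>, hence
        has a preimage under \<open>T\<close>; reflection of the relation then puts that preimage in
        the class of \<open>x\<close>.\<close>
      then obtain y where "y \<in> P" "z = T y" using r' img by blast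
      then show "z \<in> T ` (?e `` {x})" using z iff that by blast
    qed
  qed
  have sub: "C \<subseteq> P" if "C \<in> P // ?e" for C
    using that r by (auto elim!: quotientE)
  \<comment> \<open>All classes are subsets of \<open>P\<close>, where \<open>T\<close> is
    injective, so they are determined by their images.\<close>
  have "inj_on ((`) T) (P // ?e)"
    using inj sub by (meson inj_onI inj_on_image_eq_iff)
  moreover have image: "(`) T ` (P // ?e) = Q // ?e'"
    unfolding quotient_def img[symmetric] using cls by (simp add: image_UN)
  ultimately have bij: "bij_betw ((`) T) (P // ?e) (Q // ?e')"
    by (simp add: bij_betw_def)
  have ord: "(\<exists>x\<in>C. \<exists>y\<in>D. (x, y) \<in> r) \<longleftrightarrow> (\<exists>x\<in>T ` C. \<exists>y\<in>T ` D. (x, y) \<in> r')"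
    if "C \<in> P // ?e" "D \<in> P // ?e" for C D
    using sub[OF that(1)] sub[OF that(2)] iff by blast
  show ?thesis
    unfolding poset_isomorphic_def poset_reflection_def fst_conv snd_conv
    using bij ord image by (intro exI[of _ "(`) T"]) auto
qed

text \<open>Realizers in \<open>A'\<close> compose to a realizer in \<open>A'\<close>. The composite
  is restricted to \<open>X\<close> because morphisms are extensional functions.\<close>

lemma modp_hom_compose:
  assumes "elementary_sub_pca app A'"
    and f: "f \<in> modp_hom app A' X Y" and g: "g \<in> modp_hom app A' Y Z"
  shows "(\<lambda>x\<in>X. g (f x)) \<in> modp_hom app A' X Z"
proof -
  obtain k s where ks: "k \<in> A'" "s \<in> A'" "ks_combinators app k s"
    using assms(1) unfolding elementary_sub_pca_def by blast
  obtain a b where ab: "a \<in> A'" "b \<in> A'"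
    "\<forall>x\<in>X. app a x = Some (f x)" "\<forall>y\<in>Y. app b y = Some (g y)"
    and fg: "f \<in> X \<rightarrow>\<^sub>E Y" "g \<in> Y \<rightarrow>\<^sub>E Z"
    using f g unfolding modp_hom_def by blast
  obtain d where d: "d \<in> A'"
    "\<forall>x v w. app a x = Some v \<longrightarrow> app b v = Some w \<longrightarrow> app d x = Some w"
    using comp_ex[OF assms(1) ks ab(2,1)] by blast
  have "g (f x) \<in> Z" "app d x = Some (g (f x))" if "x \<in> X" for x
    using d(2) ab(3,4) fg(2) PiE_mem[OF fg(1) that] that by (auto simp: PiE_mem)
  then show ?thesis
    unfolding modp_hom_def using d(1) by auto
qed

text \<open>This is the inverse of evaluation at \<open>k\<close>. The restriction to
  \<open>{k}\<close> makes the result extensional, so that the correspondence is a bijection already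
  before passing to degrees.\<close>

definition gwp_of_pmv :: "'a \<Rightarrow> 'a pmv \<Rightarrow> 'a gwp" where
  "gwp_of_pmv k = (\<lambda>(X, f). (X, \<lambda>x\<in>{k}. f))"

lemma bij_betw_gwp_of_pmv:
  "bij_betw (gwp_of_pmv k) pmv_functions (gw_predicates {k})"
proof (rule bij_betw_byWitness[where f' = "\<lambda>(Y, F). (Y, F k)"])
  show "\<forall>p\<in>gw_predicates {k}. gwp_of_pmv k ((\<lambda>(Y, F). (Y, F k)) p) = p"
    by (auto simp: gw_predicates_def gwp_of_pmv_def PiE_iff extensional_def fun_eq_iff)
  show "gwp_of_pmv k ` pmv_functions \<subseteq> gw_predicates {k}"
    by (auto simp: gw_predicates_def pmv_functions_def gwp_of_pmv_def)
  show "(\<lambda>(Y, F). (Y, F k)) ` gw_predicates {k} \<subseteq> pmv_functions"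
    by (auto simp: gw_predicates_def pmv_functions_def)
qed (auto simp: gwp_of_pmv_def)

lemma SW_le_gwp_of_pmv_iff:
  assumes sub: "elementary_sub_pca app A'" and k: "k \<in> A'"
    and pA: "pair \<in> A'" and fstA: "fst' \<in> A'" and sndA: "snd' \<in> A'"
    and pairing: "pairing_combinators app pair fst' snd'"
  shows "SW_le app A' pair {k} (gwp_of_pmv k F) (gwp_of_pmv k G) \<longleftrightarrow> sW_le app A' F G"
proof -
  obtain X f Z g where FG: "F = (X, f)" "G = (Z, g)" by (metis surj_pair)
  let ?t = "tup app pair k"
  let ?M = "modp_prod app pair {k} X"
  \<comment> \<open>Here \<open>k\<close> serves as the point of the singleton; \<open>k0\<close>
    and \<open>s0\<close> are the combinators used to build realizers.\<close>
  obtain k0 s0 where ks: "k0 \<in> A'" "s0 \<in> A'" "ks_combinators app k0 s0"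
    using sub unfolding elementary_sub_pca_def by blast
  note combinators = sub ks pA fstA sndA pairing
  have M: "?M = ?t ` X" by (auto simp: modp_prod_def)
  have snd: "app snd' (?t x) = Some x" for x
    by (rule snd_tup[OF combinators])
  have snd_hom: "(\<lambda>p\<in>?M. the (app snd' p)) \<in> modp_hom app A' ?M X"
    unfolding modp_hom_def M using snd sndA by (auto intro!: bexI[of _ snd'])
  \<comment> \<open>The value \<open>u\<close> of \<open>pair\<close> at \<open>k\<close> is the
    same for every second component, so it realizes \<open>x \<mapsto> ?t x\<close> uniformly. It
    lies in \<open>A'\<close> because \<open>pair\<close> and \<open>k\<close> do.\<close>
  obtain u where u: "app pair k = Some u" "app u x = Some (?t x)" for x
    using tup_eq[OF combinators] by (metis option.inject)
  have "u \<in> A'" using sub_closed[OF sub ks u(1) pA k] .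
  then have pair_hom: "(\<lambda>x\<in>X. ?t x) \<in> modp_hom app A' X ?M"
    unfolding modp_hom_def M using u(2) by (auto intro!: bexI[of _ u])
  have SW: "SW_le app A' pair {k} (gwp_of_pmv k F) (gwp_of_pmv k G) \<longleftrightarrow>
      (\<exists>\<kappa>\<in>modp_hom app A' ?M Z. \<exists>h\<in>A'. \<forall>y\<in>X. \<forall>q\<in>g (\<kappa> (?t y)). \<exists>r\<in>f y. app h q = Some r)"
    by (simp add: SW_le_def gwp_of_pmv_def FG)
  show ?thesis
  proof
    assume "SW_le app A' pair {k} (gwp_of_pmv k F) (gwp_of_pmv k G)"
    then obtain \<kappa> h where \<kappa>: "\<kappa> \<in> modp_hom app A' ?M Z" and h: "h \<in> A'"
      "\<forall>y\<in>X. \<forall>q\<in>g (\<kappa> (?t y)). \<exists>r\<in>f y. app h q = Some r"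
      unfolding SW by blast
    \<comment> \<open>Precomposing with pairing turns a forward function on \<open>?M\<close> into
      one on \<open>X\<close>. The inner restriction matches the form of
      \<open>modp_hom_compose\<close> and disappears on \<open>X\<close>.\<close>
    let ?m = "\<lambda>x\<in>X. \<kappa> ((\<lambda>x\<in>X. ?t x) x)"
    have "?m \<in> modp_hom app A' X Z"
      using modp_hom_compose[OF sub pair_hom \<kappa>] .
    moreover have "\<forall>p\<in>X. \<forall>q\<in>g (?m p). \<exists>r\<in>f p. app h q = Some r"
      using h(2) by simp
    ultimately show "sW_le app A' F G"
      unfolding sW_le_def FG using h(1) by blast
  next
    assume "sW_le app A' F G"
    then obtain \<kappa> h where \<kappa>: "\<kappa> \<in> modp_hom app A' X Z" and h: "h \<in> A'"
      "\<forall>p\<in>X. \<forall>q\<in>g (\<kappa> p). \<exists>r\<in>f p. app h q = Some r"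
      unfolding sW_le_def FG by auto
    \<comment> \<open>Conversely, precompose with the second projection: at \<open>?t y\<close> it
      returns \<open>y\<close>, so the condition on \<open>h\<close> is unchanged.\<close>
    let ?m = "\<lambda>p\<in>?M. \<kappa> ((\<lambda>p\<in>?M. the (app snd' p)) p)"
    have "?m \<in> modp_hom app A' ?M Z"
      using modp_hom_compose[OF sub snd_hom \<kappa>] .
    moreover have "\<forall>y\<in>X. \<forall>q\<in>g (?m (?t y)). \<exists>r\<in>f y. app h q = Some r"
      using h(2) snd M by simp
    ultimately show "SW_le app A' pair {k} (gwp_of_pmv k F) (gwp_of_pmv k G)"
      unfolding SW using h(1) by blast
  qed
qed

theorem theorem5p17:
  fixes app :: "'a \<Rightarrow> 'a \<Rightarrow> 'a option"
    and A' :: "'a set"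
    and k s pair fst' snd' :: 'a
  assumes "pca app"
    and "elementary_sub_pca app A'"
    and "k \<in> A'" "s \<in> A'" "ks_combinators app k s"
    and "pair \<in> A'" "fst' \<in> A'" "snd' \<in> A'" "pairing_combinators app pair fst' snd'"
  shows "poset_isomorphic (sW_lattice app A') (SW app A' pair {k})"
  unfolding sW_lattice_def SW_def
proof (rule poset_reflection_isomorphic[OF bij_betw_gwp_of_pmv])
  fix F G :: "'a pmv"
  assume "F \<in> pmv_functions" "G \<in> pmv_functions"
  then show "(F, G) \<in> sW_rel app A' \<longleftrightarrow>
      (gwp_of_pmv k F, gwp_of_pmv k G) \<in> SW_rel app A' pair {k}"
    using SW_le_gwp_of_pmv_iff[OF assms(2,3,6-9)] bij_betwE[OF bij_betw_gwp_of_pmv[of k]]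
    by (simp add: sW_rel_def SW_rel_def)
qed (auto simp: sW_rel_def SW_rel_def)

end
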